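(* Let $p$ be a prime, $q=p^r$, and let $f(x)=ax^{n}+x^{m}$ be a permutation binomial of $\mathbb{F}_q$, where $a\in\mathbb{F}_q^{*}$, $n>m\geq 1$ and $\gcd(m,n)=1$. Let $d=\gcd(n-m,q-1)$. Suppose that the order of $a$ in the group $\mathbb{F}_q^{*}$ divides $\operatorname{lcm}(p-1,(q-1)/d)$. Then $p-1\leq d(d-1)$.
   Context: $\mathbb{F}_q$ is the finite field with $q$ elements. A permutation binomial of $\mathbb{F}_q$ is a binomial $ax^n+x^m$ with $a\neq 0$ whose induced map $\mathbb{F}_q\to\mathbb{F}_q$ is one to one. *)

theory Defs
  imports
    "HOL-Library.Cardinality"
    "HOL-Computational_Algebra.Computational_Algebra"
    "HOL-Algebra.Multiplicative_Group"
    "HOL-Algebra.Algebraic_Closure_Type"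
begin

definition permutation_binomial :: "'a :: {field,finite} \<Rightarrow> nat \<Rightarrow> nat \<Rightarrow> bool" where
  "permutation_binomial a n m \<longleftrightarrow>
     a \<noteq> 0 \<and> inj (poly (Polynomial.monom a n + Polynomial.monom 1 m))"

text \<open>Only meaningful for \<open>a \<noteq> 0\<close>, that is, for \<open>a\<close> in the carrier of the group of units.\<close>

definition unit_order :: "'a :: field \<Rightarrow> nat" where
  "unit_order a = group.ord (units_of (ring_of_type_algebra :: 'a ring)) a"

lemma unit_order_dvd_iff:
  fixes a :: "'a :: field"
  assumes "a \<noteq> 0"
  shows "unit_order a dvd k \<longleftrightarrow> a ^ k = 1"
proof -
  define R where "R = (ring_of_type_algebra :: 'a ring)"
  interpret R: field R
    unfolding R_def by (rule field_from_type_algebra)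
  interpret U: group "units_of R"
    by (rule R.units_group)
  have a: "a \<in> Units R"
    using assms by (simp add: R.field_Units) (simp add: R_def ring_of_type_algebra_def)
  have pow: "a [^]\<^bsub>R\<^esub> k = a ^ k"
    by (induction k) (simp_all add: R_def ring_of_type_algebra_def)
  have "a [^]\<^bsub>units_of R\<^esub> k = \<one>\<^bsub>units_of R\<^esub> \<longleftrightarrow> a ^ k = 1"
    using R.units_of_pow[OF a, of k] pow
    by (simp add: units_of_one) (simp add: R_def ring_of_type_algebra_def)
  then show ?thesis
    using U.pow_eq_id[of a k] a
    by (simp add: unit_order_def units_of_carrier R_def)
qed

end

theory Submission
  imports Defs "HOL-Number_Theory.Residues"
begin

text \<open>
  The elements whose order divides \<open>lcm (p - 1) ((q - 1) / d)\<close> are the products of an element of the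
  prime field with a \<open>d\<close>-th power. Hence \<open>a c\<^sup>n\<^sup>-\<^sup>m = b\<close> with \<open>b\<close> in the prime field for some
  \<open>c\<close>, and \<open>f (c x) = c\<^sup>m (b x\<^sup>n + x\<^sup>m)\<close>, so \<open>b x\<^sup>n + x\<^sup>m\<close> permutes the prime field.

  Put \<open>e = gcd (n - m) (p - 1)\<close> and \<open>p - 1 = e t\<close>. If \<open>e = 1\<close>, the binomial has a nonzero root in
  the prime field. Otherwise Hermite's criterion says that for \<open>0 < l < t\<close> the power sum of
  \<open>(b x\<^sup>n + x\<^sup>m)\<^sup>e\<^sup>l\<close> vanishes; its surviving terms are indexed by the multiples of \<open>t\<close> in an interval
  \<open>[l M, l M + e l]\<close>, where \<open>M\<close> is \<open>m e / (n - m)\<close> modulo \<open>t\<close>. A single multiple would leave a single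
  term, a binomial coefficient prime to \<open>p\<close> times a power of \<open>b\<close>. If \<open>e \<le> t\<close>, such an \<open>l\<close> exists
  by a Dirichlet pigeonhole argument; for \<open>e = t\<close> this needs \<open>t\<close> not to divide \<open>m\<close>, which
  follows from \<open>gcd m n = 1\<close>. So \<open>t < e\<close>, that is, \<open>p - 1 \<le> e (e - 1)\<close>, and \<open>e\<close> divides \<open>d\<close>.
\<close>

section \<open>Isolated multiples in stretched intervals\<close>

text \<open>Dirichlet's pigeonhole: the \<open>N + 1\<close> residues of \<open>l * M\<close>,
  \<open>l \<le> N\<close>, fall into \<open>N + 1\<close> blocks of length \<open>e\<close>, the
  last possibly cut off at \<open>t\<close>. If two share a block, the difference of their indices
  works; otherwise the last block is hit, and its elements lie within \<open>e\<close> of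
  \<open>t\<close>.\<close>

lemma multiple_near_zero:
  fixes e t :: nat and M :: int
  assumes "0 < e" "e < t"
  obtains l s where "1 \<le> l" "l * e < t" "\<bar>s\<bar> \<le> int e" "[int l * M = s] (mod int t)"
proof -
  define N where "N = (t - 1) div e"
  have N1: "1 \<le> N"
    unfolding N_def using assms by (simp add: Suc_leI div_greater_zero_iff)
  have Ne: "N * e \<le> t - 1" unfolding N_def by simp
  have le: "l * e < t" if "l \<le> N" for l
    using mult_le_mono1[OF that, of e] Ne assms by linarith
  define \<rho> where "\<rho> l = nat (int l * M mod int t)" for l
  have \<rho>t: "\<rho> l < t" for l
    using assms by (simp add: \<rho>_def nat_less_iff)
  have \<rho>c: "[int l * M = int (\<rho> l)] (mod int t)" for l
    using assms by (simp add: \<rho>_def cong_def)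
  define \<beta> where "\<beta> l = \<rho> l div e" for l
  have \<beta>: "\<beta> ` {..N} \<subseteq> {..N}"
  proof -
    have "\<rho> l \<le> t - 1" for l using \<rho>t[of l] by linarith
    then show ?thesis by (auto simp: \<beta>_def N_def intro: div_le_mono)
  qed
  show thesis
  proof (cases "inj_on \<beta> {..N}")
    case False
    then have "\<exists>i j. i < j \<and> j \<le> N \<and> \<beta> i = \<beta> j"
      by (metis atMost_iff linorder_inj_onI')
    then obtain i j where ij: "i < j" "j \<le> N" "\<beta> i = \<beta> j" by blast
    have "\<bar>int (\<rho> j) - int (\<rho> i)\<bar> \<le> int e"
    proof -
      have "\<rho> i = \<beta> i * e + \<rho> i mod e" "\<rho> j = \<beta> i * e + \<rho> j mod e"
        by (metis \<beta>_def div_mult_mod_eq ij(3))+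
      moreover have "\<rho> i mod e < e" "\<rho> j mod e < e" using assms by auto
      ultimately show ?thesis by linarith
    qed
    moreover have "[int (j - i) * M = int (\<rho> j) - int (\<rho> i)] (mod int t)"
      using cong_diff[OF \<rho>c[of j] \<rho>c[of i]] ij by (simp add: of_nat_diff algebra_simps)
    ultimately show thesis
      using that[of "j - i"] ij le[of "j - i"] by auto
  next
    case True
    then have "\<beta> ` {..N} = {..N}"
      using \<beta> by (simp add: endo_inj_surj)
    then obtain l where l: "l \<le> N" "\<beta> l = N" by (metis atMost_iff imageE order_refl)
    have "\<beta> 0 = 0" by (simp add: \<beta>_def \<rho>_def)
    with l N1 have l1: "1 \<le> l" by (cases l) auto
    have "N * e \<le> \<rho> l" using l(2) by (auto simp: \<beta>_def)
    moreover have "t - 1 < N * e + e"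
      unfolding N_def using assms dividend_less_div_times[of e "t - 1"] by simp
    ultimately have "\<bar>int (\<rho> l) - int t\<bar> \<le> int e"
      using \<rho>t[of l] by linarith
    moreover have "[int l * M = int (\<rho> l) - int t] (mod int t)"
      using \<rho>c[of l] by (simp add: cong_def)
    ultimately show thesis using that l1 l le by blast
  qed
qed

text \<open>Modulo \<open>t\<close> the shifts of \<open>x\<close> become those of
  \<open>\<sigma>\<close>, and the interval from \<open>\<sigma>\<close> to
  \<open>\<sigma> + w\<close> contains \<open>c * t\<close> while lying strictly between its two
  neighbouring multiples.\<close>

lemma unique_multiple_in_interval:
  fixes t w :: nat and x \<sigma> c :: int
  assumes "[x = \<sigma>] (mod int t)" "\<sigma> \<le> c * int t" "c * int t \<le> \<sigma> + int w"
    and "c * int t - int t < \<sigma>" "\<sigma> + int w < c * int t + int t"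
  obtains j where "j \<le> w" "\<And>i. i \<le> w \<Longrightarrow> int t dvd x + int i \<longleftrightarrow> i = j"
proof
  show "nat (c * int t - \<sigma>) \<le> w" using assms by linarith
next
  fix i assume i: "i \<le> w"
  have "int t dvd x + int i \<longleftrightarrow> int t dvd \<sigma> + int i"
    using assms(1) by (metis cong_add_rcancel cong_dvd_iff)
  also have "\<dots> \<longleftrightarrow> i = nat (c * int t - \<sigma>)"
  proof
    assume "int t dvd \<sigma> + int i"
    then obtain z where z: "\<sigma> + int i = z * int t" by (metis dvdE mult.commute)
    have "(c - 1) * int t < z * int t" "z * int t < (c + 1) * int t"
      using assms i z by (simp_all add: left_diff_distrib distrib_right)
    then have "c - 1 < z" "z < c + 1"
      by (simp_all only: mult_less_cancel_right)
    then have "z = c" by simp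
    then show "i = nat (c * int t - \<sigma>)" using z by simp
  next
    assume "i = nat (c * int t - \<sigma>)"
    then have "\<sigma> + int i = c * int t" using assms by simp
    then show "int t dvd \<sigma> + int i" by simp
  qed
  finally show "int t dvd x + int i \<longleftrightarrow> i = nat (c * int t - \<sigma>)" .
qed

text \<open>For \<open>e = t\<close>, take \<open>l = 1\<close>. For \<open>e < t\<close>, start
  from \<open>l\<close> and \<open>s\<close> of \<open>multiple_near_zero\<close>: the interval
  \<open>[s, s + e * l]\<close> isolates 0 if \<open>s \<le> 0\<close>; if \<open>s > 0\<close>, a
  suitable dilation of it isolates \<open>t\<close>.\<close>

lemma ex_unique_multiple:
  fixes e t :: nat and M :: int
  assumes e: "2 \<le> e" "e \<le> t" and M: "e = t \<Longrightarrow> \<not> int t dvd M"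
  obtains l j where "1 \<le> l" "l < t" "j \<le> e * l"
    "\<And>i. i \<le> e * l \<Longrightarrow> int t dvd int l * M + int i \<longleftrightarrow> i = j"
proof (cases "e = t")
  case True
  define \<sigma> where "\<sigma> = M mod int t"
  have t0: "int t > 0" using e by simp
  have "\<sigma> \<noteq> 0" using M[OF True] by (auto simp: \<sigma>_def)
  then have \<sigma>: "0 < \<sigma>" "\<sigma> < int t"
    using pos_mod_bound[OF t0, of M] pos_mod_sign[OF t0, of M] unfolding \<sigma>_def by linarith+
  obtain j where "j \<le> e" "\<And>i. i \<le> e \<Longrightarrow> int t dvd M + int i \<longleftrightarrow> i = j"
    \<comment> \<open>As \<open>0 < \<sigma> < t\<close>, the interval
      \<open>[\<sigma>, \<sigma> + t]\<close> meets only the multiple \<open>1 * t\<close>.\<close>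
    by (rule unique_multiple_in_interval[of M \<sigma> t 1 e])
      (use \<sigma> True in \<open>auto simp: \<sigma>_def cong_def\<close>)
  then show thesis using that[of 1 j] e by simp
next
  case False
  with e have et: "0 < e" "e < t" by auto
  obtain l s where l: "1 \<le> l" "l * e < t" "\<bar>s\<bar> \<le> int e" "[int l * M = s] (mod int t)"
    using multiple_near_zero[OF et] .
  have le: "e \<le> e * l" using l(1) by simp
  have lt: "l < t"
    using l e mult_le_mono2[of 1 e l] by linarith
  show thesis
  proof (cases "s \<le> 0")
    case True
    have "int (e * l) < int t" using l(2) by (simp only: of_nat_less_iff mult.commute)
    moreover have "int e \<le> int (e * l)" using le by (simp only: of_nat_le_iff)
    ultimately have "0 \<le> s + int (e * l)" "- int t < s" "s + int (e * l) < int t"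
      using True l(3) et by linarith+
    then have *: "s \<le> 0 * int t" "0 * int t \<le> s + int (e * l)" "0 * int t - int t < s"
        "s + int (e * l) < 0 * int t + int t"
      using True by (auto simp del: of_nat_mult)
    obtain j where "j \<le> e * l" "\<And>i. i \<le> e * l \<Longrightarrow> int t dvd int l * M + int i \<longleftrightarrow> i = j"
      using unique_multiple_in_interval[OF l(4) *] by blast
    then show thesis using that l lt by blast
  next
    case False
    define u where "u = nat s"
    have s: "s = int u" and u: "0 < u" "u \<le> e" using False l(3) by (auto simp: u_def)
    define S where "S = u + l * e"
    have S0: "0 < S" using u by (simp add: S_def)
    \<comment> \<open>The least \<open>k + 1\<close> with \<open>(k + 1) S \<ge> t\<close>: the \<open>(k + 1)\<close>-fold stretched interval
      \<open>[(k + 1) u, (k + 1) S]\<close> then contains \<open>t\<close> and no other multiple of \<open>t\<close>.\<close>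
    define k where "k = (t - 1) div S"
    have k1: "k * S < t"
      using div_times_less_eq_dividend[of "t - 1" S] et unfolding k_def by linarith
    have k2: "t \<le> Suc k * S"
      using dividend_less_div_times[OF S0, of "t - 1"] by (simp add: k_def)
    have u2: "2 * u \<le> S"
      using le u(2) unfolding S_def mult.commute[of l e] by linarith
    \<comment> \<open>The next three bounds keep the left end and the new multiplier below
      \<open>t\<close> and the right end below \<open>2 * t\<close>. For \<open>k > 0\<close> they
      follow from \<open>k * S < t\<close>, as \<open>Suc k \<le> 2 * k\<close> and \<open>S\<close>
      is at least \<open>2 * u\<close> and \<open>2 * l\<close>.\<close>
    have ku: "Suc k * u < t"
    proof (cases "k = 0")
      case True
      then show ?thesis using u et by simp
    next
      case False
      then have "Suc k * u \<le> k * (2 * u)" by (cases k) auto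
      also have "\<dots> \<le> k * S" using u2 by (rule mult_le_mono2)
      finally show ?thesis using k1 by simp
    qed
    have kl: "Suc k * l < t"
    proof (cases "k = 0")
      case True
      then show ?thesis using lt by simp
    next
      case False
      then have "Suc k * l \<le> k * (2 * l)" by (cases k) auto
      also have "2 * l \<le> S" using mult_le_mono2[OF e(1), of l] unfolding S_def by linarith
      then have "k * (2 * l) \<le> k * S" by (rule mult_le_mono2)
      finally show ?thesis using k1 by simp
    qed
    have kS: "Suc k * S < 2 * t"
    proof (cases "k = 0")
      case True
      then show ?thesis using u et l(2) by (simp add: S_def)
    next
      case False
      then have "S \<le> k * S" by simp
      then show ?thesis using k1 unfolding mult_Suc by linarith
    qed
    let ?L = "Suc k * l"
    have c: "[int ?L * M = int (Suc k * u)] (mod int t)"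
      using cong_scalar_left[OF l(4), of "int (Suc k)"]
      by (simp only: s of_nat_mult mult.assoc)
    have Seq: "Suc k * u + e * ?L = Suc k * S" by (simp add: S_def algebra_simps)
    have h: "int (Suc k * u) + int (e * ?L) = int (Suc k * S)"
      using Seq by (metis of_nat_add)
    have "0 < Suc k * u" using u by simp
    then have *: "int (Suc k * u) \<le> 1 * int t" "1 * int t \<le> int (Suc k * u) + int (e * ?L)"
        "1 * int t - int t < int (Suc k * u)" "int (Suc k * u) + int (e * ?L) < 1 * int t + int t"
      using ku k2 kS h by linarith+
    obtain j where "j \<le> e * ?L" "\<And>i. i \<le> e * ?L \<Longrightarrow> int t dvd int ?L * M + int i \<longleftrightarrow> i = j"
      using unique_multiple_in_interval[OF c *] by blast
    then show thesis using that[of ?L j] kl l(1) by simp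
  qed
qed

section \<open>Finite fields\<close>

lemma power_eq_imp_order_dvd_diff:
  fixes x :: "'a :: field"
  assumes "x \<noteq> 0" "\<And>i. x ^ i = 1 \<longleftrightarrow> N dvd i" "i \<le> j" "x ^ i = x ^ j"
  shows "N dvd j - i"
proof -
  have "x ^ j = x ^ i * x ^ (j - i)" using assms(3) by (metis le_add_diff_inverse power_add)
  then show ?thesis using assms by simp
qed

lemma inj_on_power_order:
  fixes x :: "'a :: field"
  assumes "x \<noteq> 0" "\<And>i. x ^ i = 1 \<longleftrightarrow> N dvd i"
  shows "inj_on (\<lambda>i. x ^ i) {..<N}"
proof (rule linorder_inj_onI')
  fix i j assume ij: "i \<in> {..<N}" "j \<in> {..<N}" "i < j"
  then show "x ^ i \<noteq> x ^ j"
    using power_eq_imp_order_dvd_diff[OF assms, of i j] by (auto dest!: dvd_imp_le)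
qed

text \<open>The multiplicative group is cyclic; the order \<open>N\<close> of a generator is found
  by counting, since its first \<open>N\<close> powers are distinct and exhaust the nonzero
  elements.\<close>

lemma finite_field_generator:
  obtains g :: "'a :: {field, finite}"
  where "g \<noteq> 0" "\<And>x. x \<noteq> 0 \<Longrightarrow> \<exists>i. x = g ^ i" "\<And>i. g ^ i = 1 \<longleftrightarrow> CARD('a) - 1 dvd i"
proof -
  define R where "R = (ring_of_type_algebra :: 'a ring)"
  interpret R: field R
    unfolding R_def by (rule field_from_type_algebra)
  have pow: "x [^]\<^bsub>R\<^esub> k = x ^ k" for x and k :: nat
    by (induction k) (simp_all add: R_def ring_of_type_algebra_def)
  have carrier: "carrier (mult_of R) = UNIV - {0}"
    by (simp add: R_def ring_of_type_algebra_def)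
  obtain g where g: "g \<in> carrier (mult_of R)"
      "carrier (mult_of R) = {g [^]\<^bsub>R\<^esub> i |i :: nat. i \<in> UNIV}"
    using R.finite_field_mult_group_has_gen by auto
  have g0: "g \<noteq> 0" using g(1) unfolding carrier by simp
  have gen: "UNIV - {0} = range (\<lambda>i. g ^ i)"
    using g(2) unfolding carrier pow by auto
  define N where "N = unit_order g"
  have N: "g ^ i = 1 \<longleftrightarrow> N dvd i" for i
    using unit_order_dvd_iff[OF g0, of i] by (simp add: N_def)
  \<comment> \<open>The value 0 would stand for infinite order, making all powers of
    \<open>g\<close> distinct.\<close>
  have "N \<noteq> 0"
  proof
    assume "N = 0"
    then have "inj (\<lambda>i. g ^ i)"
      using power_eq_imp_order_dvd_diff[OF g0 N] by (intro linorder_injI) (metis diff_is_0_eq dvd_0_left_iff leD less_imp_le)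
    then show False using finite_imageD[of "\<lambda>i. g ^ i" UNIV] by simp
  qed
  moreover have "inj_on (\<lambda>i. g ^ i) {..<N}"
    using g0 N by (rule inj_on_power_order)
  moreover have "(\<lambda>i. g ^ i) ` {..<N} = UNIV - {0}"
  proof -
    have "g ^ i \<in> (\<lambda>i. g ^ i) ` {..<N}" for i
    proof
      have "g ^ i = g ^ (N * (i div N) + i mod N)" by simp
      also have "\<dots> = g ^ (i mod N)" using N[of N] by (simp only: power_add power_mult) simp
      finally show "g ^ i = g ^ (i mod N)" .
    qed (use \<open>N \<noteq> 0\<close> in simp)
    then show ?thesis unfolding gen by auto
  qed
  ultimately have "N = card (UNIV - {0 :: 'a})" using card_image by fastforce
  then have "N = CARD('a) - 1" by (simp add: card_Diff_singleton)
  then show thesis using that[OF g0] gen N by blast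
qed

lemma power_cong_order:
  fixes x :: "'a :: monoid_mult"
  assumes "x ^ N = 1" "[i = j] (mod N)"
  shows "x ^ i = x ^ j"
proof -
  have "x ^ k = x ^ (k mod N)" for k
    by (metis assms(1) mult_div_mod_eq mult_1 power_add power_mult power_one)
  then show ?thesis using assms(2) by (metis cong_def)
qed

lemma CHAR_finite_field:
  assumes "prime p" "CARD('a :: {field, finite}) = p ^ r"
  shows "CHAR('a) = p"
proof -
  have "prime CHAR('a)"
    using finite_imp_CHAR_pos[where ?'a = 'a] prime_CHAR_semidom by auto
  moreover have "CHAR('a) dvd p ^ r"
    using CHAR_dvd_CARD[where ?'a = 'a] assms(2) by simp
  ultimately show ?thesis
    using assms(1) by (metis prime_dvd_power primes_dvd_imp_eq)
qed

lemma prime_minus_one_dvd_power_minus_one: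
  fixes p :: nat
  assumes "prime p"
  shows "p - 1 dvd p ^ r - 1"
proof -
  have p: "1 \<le> p" using prime_gt_0_nat[OF assms] by simp
  then have "[p = 1] (mod (p - 1))" by (simp add: cong_altdef_nat)
  from cong_pow[OF this, of r] show ?thesis using p by (simp add: cong_altdef_nat)
qed

text \<open>The roots are the \<open>N\<close> powers of a primitive root \<open>h\<close>. If
  \<open>N\<close> divides \<open>i\<close>, every term is 1; otherwise multiplication by
  \<open>h\<close> permutes the roots and scales the sum by \<open>h ^ i\<close>, which is not
  1.\<close>

lemma sum_powers_roots_of_unity:
  fixes N :: nat
  assumes "N dvd CARD('a :: {field, finite}) - 1" "0 < N"
  shows "(\<Sum>x | (x :: 'a) ^ N = 1. x ^ i) = (if N dvd i then of_nat N else 0)"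
proof -
  obtain g :: 'a where g: "g \<noteq> 0" "\<And>x. x \<noteq> 0 \<Longrightarrow> \<exists>i. x = g ^ i"
      "\<And>i. g ^ i = 1 \<longleftrightarrow> CARD('a) - 1 dvd i"
    using finite_field_generator[where ?'a = 'a] by blast
  have "CARD('a) \<ge> card {0, 1 :: 'a}" by (rule card_mono) auto
  then have Q0: "CARD('a) - 1 > 0" by simp
  obtain A where A: "CARD('a) - 1 = N * A" using assms(1) by blast
  have A0: "A > 0" using A Q0 by (cases A) auto
  define h where "h = g ^ A"
  have h: "h ^ i = 1 \<longleftrightarrow> N dvd i" for i
  proof -
    have "h ^ i = 1 \<longleftrightarrow> N * A dvd i * A"
      by (simp only: h_def g(3) A mult.commute[of A] flip: power_mult)
    then show ?thesis using A0 by simp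
  qed
  have h0: "h \<noteq> 0" using g(1) by (simp add: h_def)
  define U where "U = {x :: 'a. x ^ N = 1}"
  show ?thesis
  proof (cases "N dvd i")
    case True
    have "inj_on (\<lambda>i. h ^ i) {..<N}"
      using h0 h by (rule inj_on_power_order)
    moreover have "(\<lambda>i. h ^ i) ` {..<N} = U"
    proof (intro equalityI subsetI)
      fix x assume "x \<in> (\<lambda>i. h ^ i) ` {..<N}"
      then show "x \<in> U" by (auto simp: U_def h simp flip: power_mult)
    next
      fix x assume x: "x \<in> U"
      then have "x \<noteq> 0" using assms(2) by (auto simp: U_def power_0_left)
      then obtain j where j: "x = g ^ j" using g(2) by blast
      then have "N * A dvd j * N" using x g(3)[of "j * N"] A by (simp add: U_def power_mult)
      then have "A dvd j" using assms(2) by (simp add: mult.commute)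
      then obtain k where k: "j = A * k" by blast
      have "x = h ^ k" by (simp add: j k h_def power_mult)
      also have "\<dots> = h ^ (k mod N)"
        by (rule power_cong_order[of _ N]) (simp_all add: h cong_def)
      finally show "x \<in> (\<lambda>i. h ^ i) ` {..<N}" using assms(2) by auto
    qed
    ultimately have "card U = N" using card_image by fastforce
    moreover have "x ^ i = 1" if "x \<in> U" for x
      using True that by (auto simp: U_def power_mult)
    ultimately show ?thesis using True unfolding U_def[symmetric] by simp
  next
    case False
    have "h ^ i * (\<Sum>x\<in>U. x ^ i) = (\<Sum>x\<in>U. (h * x) ^ i)"
      by (simp add: sum_distrib_left power_mult_distrib)
    also have "\<dots> = (\<Sum>x\<in>U. x ^ i)"
    proof (rule sum.reindex_bij_witness[of _ "\<lambda>x. x / h" "\<lambda>x. h * x"])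
    qed (use h0 h[of N] in \<open>auto simp: U_def power_mult_distrib power_divide\<close>)
    finally have "(h ^ i - 1) * (\<Sum>x\<in>U. x ^ i) = 0" by (simp add: algebra_simps)
    then show ?thesis using False h[of i] unfolding U_def[symmetric] by simp
  qed
qed


section \<open>Binomials over the prime field\<close>

text \<open>Frobenius is a ring homomorphism whose fixed points form the prime field, so a binomial
  with coefficient in the prime field maps that field into itself.\<close>

lemma power_CHAR_binomial:
  fixes b x :: "'a :: {field, finite}"
  assumes "b ^ CHAR('a) = b" "x ^ CHAR('a) = x"
  shows "(b * x ^ n + x ^ m) ^ CHAR('a) = b * x ^ n + x ^ m"
proof -
  have prime: "prime CHAR('a)"
    using finite_imp_CHAR_pos[where ?'a = 'a] prime_CHAR_semidom by auto
  have "(x ^ i) ^ CHAR('a) = x ^ i" for i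
    using assms(2) by (metis power_commutes power_mult mult.commute)
  then show ?thesis
    using freshmans_dream[OF prime refl, of "b * x ^ n" "x ^ m"] assms(1)
    by (simp add: power_mult_distrib)
qed

text \<open>The nonzero elements of the prime field appear as the group \<open>U\<close> of
  \<open>(p - 1)\<close>-st roots of unity, which the binomial permutes; Hermite's criterion becomes
  a comparison of power sums over \<open>U\<close>.\<close>

lemma permutation_binomial_prime_subfield_bound:
  fixes b :: "'a :: {field, finite}" and p r n m :: nat
  assumes prime: "prime p" and card: "CARD('a) = p ^ r"
    and nm: "m < n" "1 \<le> m" "coprime m n"
    and b: "b ^ (p - 1) = 1"
    and inj: "inj (\<lambda>x. b * x ^ n + x ^ m)"
  defines "e \<equiv> gcd (n - m) (p - 1)"
  shows "p - 1 \<le> e * (e - 1)"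
proof (rule ccontr)
  assume neg: "\<not> p - 1 \<le> e * (e - 1)"
  note CHAR = CHAR_finite_field[OF prime card]
  have p2: "2 \<le> p" using prime by (rule prime_ge_2_nat)
  have p1: "Suc (p - 1) = p" using p2 by simp
  define F where "F x = b * x ^ n + x ^ m" for x
  have injF: "inj F" using inj unfolding F_def .
  have F0: "F 0 = 0" using nm by (simp add: F_def power_0_left)
  have F_nz: "F x \<noteq> 0" if "x \<noteq> 0" for x
    using injF F0 that by (metis injD)
  have CH: "y ^ (p - 1) = 1" if "y ^ p = y" "y \<noteq> 0" for y :: 'a
    using that p1 by (metis mult_cancel_left1 power_Suc)
  have CH': "y ^ p = y" if "y ^ (p - 1) = 1" for y :: 'a
    using that p1 by (metis mult.right_neutral power_Suc)
  define U where "U = {x :: 'a. x ^ (p - 1) = 1}"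
  have U_nz: "x \<noteq> 0" if "x \<in> U" for x
    using that p2 by (auto simp: U_def power_0_left)
  have FU: "F ` U = U"
  proof (rule endo_inj_surj)
    show "F ` U \<subseteq> U"
    proof
      fix y assume "y \<in> F ` U"
      then obtain x where x: "x \<in> U" "y = F x" by blast
      have "F x ^ p = F x"
        using power_CHAR_binomial[of b x n m] CH' b x(1) by (simp add: F_def U_def CHAR)
      then show "y \<in> U" using CH F_nz U_nz x by (simp add: U_def)
    qed
    show "inj_on F U" using injF subset_UNIV by (rule inj_on_subset)
  qed simp
  have "p - 1 dvd CARD('a) - 1"
    using prime_minus_one_dvd_power_minus_one[OF prime] by (simp add: card)
  \<comment> \<open>The value \<open>- 1\<close> is \<open>p - 1\<close> read in characteristic
    \<open>p\<close>.\<close>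
  then have S: "(\<Sum>x\<in>U. x ^ i) = (if p - 1 dvd i then - 1 else 0)" for i
    using sum_powers_roots_of_unity[where ?'a = 'a, where N = "p - 1" and i = i] p2
      of_nat_CHAR[where ?'a = 'a]
    unfolding U_def CHAR by (simp add: of_nat_diff)
  have hermite: "(\<Sum>x\<in>U. F x ^ k) = (\<Sum>x\<in>U. x ^ k)" for k
    using sum.reindex[OF inj_on_subset[OF injF subset_UNIV, of U], of "\<lambda>x. x ^ k"] FU by simp
  have expand: "(\<Sum>x\<in>U. F x ^ k) =
      (\<Sum>i\<le>k. of_nat (k choose i) * b ^ i * (if p - 1 dvd m * k + (n - m) * i then - 1 else 0))" for k
  proof -
    have "(\<Sum>x\<in>U. F x ^ k) =
        (\<Sum>x\<in>U. \<Sum>i\<le>k. of_nat (k choose i) * b ^ i * x ^ (m * k + (n - m) * i))"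
    proof (intro sum.cong refl)
      fix x :: 'a
      have "x ^ (n * i) * x ^ (m * (k - i)) = x ^ (m * k + (n - m) * i)" if "i \<le> k" for i
      proof -
        have "n * i + m * (k - i) = m * k + (n - m) * i"
          using that nm(1) by (simp add: nat_eq_iff algebra_simps diff_mult_distrib2)
        then show ?thesis by (metis power_add)
      qed
      then show "F x ^ k = (\<Sum>i\<le>k. of_nat (k choose i) * b ^ i * x ^ (m * k + (n - m) * i))"
        unfolding F_def binomial_ring
        by (intro sum.cong refl) (simp add: power_mult_distrib mult.assoc flip: power_mult)
    qed
    also have "\<dots> = (\<Sum>i\<le>k. of_nat (k choose i) * b ^ i * (\<Sum>x\<in>U. x ^ (m * k + (n - m) * i)))"
      by (subst sum.swap) (simp add: sum_distrib_left)
    finally show ?thesis by (simp only: S)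
  qed
  have e0: "e > 0" using p2 by (simp add: e_def)
  then obtain g t where g: "n - m = g * e" and t: "p - 1 = t * e" and gt: "coprime g t"
    using gcd_coprime_exists[of "n - m" "p - 1"] unfolding e_def by blast
  note g = g[unfolded mult.commute[of g]] and t = t[unfolded mult.commute[of t]]
  have "e \<noteq> 1"
  proof
    assume "e = 1"
    then obtain w where w: "[(n - m) * w = Suc 0] (mod (p - 1))"
      using cong_solve_coprime_nat[of "n - m" "p - 1"] by (auto simp: e_def coprime_iff_gcd_eq_1)
    \<comment> \<open>A nonzero root \<open>x\<close> of \<open>F\<close> must satisfy
      \<open>x ^ (n - m) = y\<close>; as \<open>w\<close> inverts \<open>n - m\<close> modulo
      \<open>p - 1\<close>, \<open>y ^ w\<close> is such a root.\<close>
    define y where "y = - inverse b"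
    have b0: "b \<noteq> 0" using b p2 by (auto simp: power_0_left)
    have "(- 1 :: 'a) ^ p = - 1"
      using minus_power_prime_CHAR[where ?'a = 'a, of p 1] prime by (simp add: CHAR)
    then have "(- 1 :: 'a) ^ (p - 1) = 1" by (intro CH) auto
    moreover have "y = - 1 * inverse b" by (simp add: y_def)
    ultimately have y: "y ^ (p - 1) = 1"
      using b by (simp only: power_mult_distrib power_inverse) simp
    have "(y ^ w) ^ (n - m) = y"
      using power_cong_order[OF y w] by (simp add: mult.commute flip: power_mult)
    moreover have "(y ^ w) ^ n = (y ^ w) ^ m * (y ^ w) ^ (n - m)"
      using nm(1) by (metis le_add_diff_inverse less_imp_le power_add)
    ultimately have "(y ^ w) ^ n = (y ^ w) ^ m * y" by (simp only:)
    then have "F (y ^ w) = (y ^ w) ^ m * (b * y + 1)"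
      unfolding F_def by (simp only: distrib_left distrib_right mult_ac mult_1_left mult_1_right)
    also have "\<dots> = 0" using b0 by (simp add: y_def)
    finally have "y ^ w = 0" using F_nz by blast
    then show False using b0 by (simp add: y_def)
  qed
  with e0 have e2: "2 \<le> e" by simp
  have et: "e \<le> t"
  proof (rule ccontr)
    assume "\<not> e \<le> t"
    then have "e * t \<le> e * (e - 1)" by (intro mult_le_mono2) simp
    then show False using neg t by simp
  qed
  \<comment> \<open>With \<open>w\<close> inverse to \<open>g = (n - m) / e\<close>, the product
    \<open>m * w\<close> is the multiplier \<open>M\<close> of the interval lemma.\<close>
  obtain w where w: "[g * w = Suc 0] (mod t)"
    using cong_solve_coprime_nat[OF gt] by auto
  then have wt: "coprime w t"
    by (metis coprime_mult_left_iff cong_imp_coprime cong_sym coprime_Suc_0_left)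
  \<comment> \<open>If \<open>e\<close> divided \<open>m\<close>, it would also divide
    \<open>n\<close>, because it divides \<open>n - m\<close>.\<close>
  have M: "\<not> int t dvd int (m * w)" if "e = t"
  proof
    assume "int t dvd int (m * w)"
    then have "t dvd m * w" by (simp only: int_dvd_int_iff)
    then have "e dvd m" using wt that by (simp add: coprime_dvd_mult_left_iff coprime_commute)
    moreover from this have "e dvd n"
      using g nm(1) by (metis dvd_add_right_iff dvd_triv_left le_add_diff_inverse less_imp_le)
    ultimately have "is_unit e" using nm(3) by (meson coprime_common_divisor)
    then show False using e2 by simp
  qed
  obtain l j where l: "1 \<le> l" "l < t" "j \<le> e * l"
      and lj: "\<And>i. i \<le> e * l \<Longrightarrow> int t dvd int l * int (m * w) + int i \<longleftrightarrow> i = j"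
    using ex_unique_multiple[OF e2 et M] by blast
  define k where "k = e * l"
  have k: "0 < k" "k < p - 1" using l e2 t by (auto simp: k_def)
  \<comment> \<open>Cancelling \<open>e\<close> and multiplying by the unit \<open>w\<close> turns
    the survival condition on \<open>i\<close> into the interval condition, which singles out
    \<open>j\<close>.\<close>
  have dvd: "p - 1 dvd m * k + (n - m) * i \<longleftrightarrow> i = j" if "i \<le> k" for i
  proof -
    have "[l * (m * w) + g * w * i = l * (m * w) + Suc 0 * i] (mod t)"
      using w by (intro cong_add cong_scalar_right) auto
    moreover have "l * (m * w) + g * w * i = w * (m * l + g * i)" by (simp add: algebra_simps)
    ultimately have cong: "[w * (m * l + g * i) = l * (m * w) + i] (mod t)" by simp
    have "p - 1 dvd m * k + (n - m) * i \<longleftrightarrow> e * t dvd e * (m * l + g * i)"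
      unfolding t g k_def by (simp add: algebra_simps)
    also have "\<dots> \<longleftrightarrow> t dvd m * l + g * i" using e0 by simp
    also have "\<dots> \<longleftrightarrow> t dvd w * (m * l + g * i)"
      using wt by (simp add: coprime_dvd_mult_right_iff coprime_commute)
    also have "\<dots> \<longleftrightarrow> t dvd l * (m * w) + i" using cong by (rule cong_dvd_iff)
    also have "\<dots> \<longleftrightarrow> int t dvd int l * int (m * w) + int i"
      by (simp flip: int_dvd_int_iff)
    also have "\<dots> \<longleftrightarrow> i = j" using lj that by (simp add: k_def)
    finally show ?thesis .
  qed
  have "\<not> p - 1 dvd k" using k by (auto dest: dvd_imp_le)
  then have "0 = (\<Sum>x\<in>U. F x ^ k)" by (simp only: hermite S if_False)
  also have "\<dots> = (\<Sum>i\<le>k. if i = j then - (of_nat (k choose i) * b ^ i) else 0)"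
    unfolding expand by (intro sum.cong refl) (simp add: dvd[unfolded One_nat_def])
  also have "\<dots> = - (of_nat (k choose j) * b ^ j)" using l(3) by (simp add: k_def)
  finally have "of_nat (k choose j) = (0 :: 'a)" using b p2 by (auto simp: power_0_left)
  then have "p dvd k choose j" by (simp add: of_nat_eq_0_iff_char_dvd CHAR)
  \<comment> \<open>Since \<open>k < p\<close>, the factorial of \<open>k\<close> is prime to
    \<open>p\<close>.\<close>
  moreover have "k choose j dvd fact k"
    using binomial_fact_lemma[of j k] l(3) by (metis dvd_triv_right k_def)
  ultimately have "p dvd fact k" by (rule dvd_trans)
  then show False using prime k by (simp add: prime_dvd_fact_iff)
qed

section \<open>Reduction to a coefficient in the prime field\<close>

theorem corollary5:
  fixes a :: "'a :: {field,finite}" and p r q n m d :: nat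
  assumes "prime p"
    and "q = p ^ r"
    and "CARD('a) = q"
    and "n > m" and "m \<ge> 1"
    and "gcd m n = 1"
    and "permutation_binomial a n m"
    and "d = gcd (n - m) (q - 1)"
    and "unit_order a dvd lcm (p - 1) ((q - 1) div d)"
  shows "p - 1 \<le> d * (d - 1)"
proof -
  define Q where "Q = q - 1"
  have "card {0, 1 :: 'a} \<le> CARD('a)" by (rule card_mono) auto
  then have Q0: "0 < Q" using assms(3) by (simp add: Q_def)
  have p2: "2 \<le> p" using assms(1) by (rule prime_ge_2_nat)
  obtain g :: 'a where g: "g \<noteq> 0" "\<And>x. x \<noteq> 0 \<Longrightarrow> \<exists>i. x = g ^ i"
      "\<And>i. g ^ i = 1 \<longleftrightarrow> CARD('a) - 1 dvd i"
    using finite_field_generator[where ?'a = 'a] by blast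
  have gQ: "g ^ k = 1 \<longleftrightarrow> Q dvd k" for k using g(3) assms(3) by (simp add: Q_def)
  have "poly (Polynomial.monom a n + Polynomial.monom 1 m) = (\<lambda>x. a * x ^ n + x ^ m)"
    by (rule ext) (simp add: poly_monom)
  then have a0: "a \<noteq> 0" and inj: "inj (\<lambda>x. a * x ^ n + x ^ m)"
    using assms(7) unfolding permutation_binomial_def by simp_all
  have pQ: "p - 1 dvd Q"
    using prime_minus_one_dvd_power_minus_one[OF assms(1)] by (simp add: Q_def assms(2))
  then obtain A where A: "Q = (p - 1) * A" by blast
  have A0: "0 < A" using A Q0 by (cases A) auto
  have d: "d = gcd (n - m) Q" using assms(8) by (simp add: Q_def)
  have d0: "0 < d" using assms(4) by (simp add: d)
  have dQ: "d dvd Q" by (simp add: d)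
  \<comment> \<open>Nonzero prime field elements are the powers of \<open>g ^ A\<close>, and nonzero
    \<open>d\<close>-th powers those of \<open>g ^ d\<close>; their products are the powers of
    \<open>g ^ G\<close>. The order condition will force \<open>G\<close> to divide the exponent
    \<open>i\<close> of \<open>a\<close>.\<close>
  define G where "G = gcd A d"
  have G0: "0 < G" using d0 by (simp add: G_def)
  obtain A' d' where A': "A = G * A'" and d': "d = G * d'"
    unfolding G_def by (meson dvdE gcd_dvd1 gcd_dvd2)
  obtain Q' where Q': "Q = d * Q'" using dQ by blast
  have "p - 1 dvd Q div G" using G0 by (simp add: A A')
  moreover have "Q div d dvd Q div G" using G0 d0 by (simp add: Q' d')
  ultimately have "unit_order a dvd Q div G"
    using assms(9) unfolding Q_def[symmetric] by (meson dvd_trans lcm_least)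
  then have aG: "a ^ (Q div G) = 1" using a0 by (simp add: unit_order_dvd_iff)
  obtain i where i: "a = g ^ i" using g(2) a0 by blast
  have "Q dvd i * (Q div G)" using aG gQ by (simp add: i flip: power_mult)
  moreover have QG: "Q = G * (Q div G)" using dQ d' by (metis dvd_mult_div_cancel dvd_mult_left)
  ultimately have "G * (Q div G) dvd i * (Q div G)" by simp
  moreover have "Q div G \<noteq> 0" using QG Q0 by (metis mult_0_right not_less_zero)
  ultimately have "G dvd i" by simp
  then obtain z where z: "i = G * z" by blast
  obtain u where "[A * u = G] (mod d)"
    using cong_solve_nat[of A d] A0 by (auto simp: G_def)
  \<comment> \<open>The summand with factor \<open>d\<close> is harmless modulo \<open>d\<close> and
    makes the exponent at least \<open>i\<close>, so that \<open>y\<close> below can be a natural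
    number.\<close>
  then have "[A * u * z + d * (A * i) = i + d * 0] (mod d)"
    unfolding z by (intro cong_add cong_scalar_right) (auto simp: cong_def)
  then have "[A * (u * z + d * i) = i] (mod d)" by (simp add: algebra_simps)
  moreover have "i \<le> A * (d * i)" using A0 d0 by simp
  then have le: "i \<le> A * (u * z + d * i)" unfolding distrib_left by (rule trans_le_add2)
  ultimately have "d dvd A * (u * z + d * i) - i" by (simp add: cong_altdef_nat)
  then obtain y where "A * (u * z + d * i) - i = d * y" by blast
  then have y: "A * (u * z + d * i) = i + d * y" using le by simp
  \<comment> \<open>Every power of \<open>g ^ d\<close> is thus an \<open>(n - m)\<close>-th power,
    which yields \<open>c\<close>.\<close>
  obtain v where v: "[(n - m) * v = d] (mod Q)"
    using cong_solve_nat[of "n - m" Q] assms(4) by (auto simp: d)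
  define b where "b = g ^ (A * (u * z + d * i))"
  define c where "c = g ^ (v * y)"
  have c0: "c \<noteq> 0" using g(1) by (simp add: c_def)
  have "[i + (n - m) * v * y = i + d * y] (mod Q)"
    using v by (intro cong_add cong_scalar_right) auto
  then have "g ^ (i + (n - m) * v * y) = b"
    unfolding b_def y by (intro power_cong_order[of g Q]) (simp_all add: gQ)
  then have ab: "a * c ^ (n - m) = b"
    by (simp add: i c_def power_add mult_ac flip: power_mult)
  have b1: "b ^ (p - 1) = 1"
    by (simp add: b_def gQ A mult_ac flip: power_mult)
  have scale: "a * (c * x) ^ n + (c * x) ^ m = c ^ m * (b * x ^ n + x ^ m)" for x
  proof -
    have "c ^ n = c ^ m * c ^ (n - m)" using assms(4) by (simp flip: power_add)
    then show ?thesis by (simp add: power_mult_distrib algebra_simps flip: ab)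
  qed
  have injb: "inj (\<lambda>x. b * x ^ n + x ^ m)"
  proof (rule injI)
    fix x y assume "b * x ^ n + x ^ m = b * y ^ n + y ^ m"
    then have "a * (c * x) ^ n + (c * x) ^ m = a * (c * y) ^ n + (c * y) ^ m"
      by (simp only: scale)
    then have "c * x = c * y" by (rule injD[OF inj])
    then show "x = y" using c0 by simp
  qed
  have "coprime m n" using assms(6) by (simp add: coprime_iff_gcd_eq_1)
  then have "p - 1 \<le> gcd (n - m) (p - 1) * (gcd (n - m) (p - 1) - 1)"
    using assms(1-5) b1 injb by (intro permutation_binomial_prime_subfield_bound[of p r m n b]) auto
  also have "gcd (n - m) (p - 1) \<le> d"
    using d0 pQ unfolding d by (intro dvd_imp_le gcd_mono) auto
  then have "gcd (n - m) (p - 1) * (gcd (n - m) (p - 1) - 1) \<le> d * (d - 1)"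
    by (intro mult_le_mono) auto
  finally show ?thesis .
qed

end
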